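(* Consider the online problem and Algorithm 2 described in the context, and assume the standing assumptions there (boundedness/convexity, Slater condition with constant $\epsilon>0$, and $\epsilon>\bar V_{\boldsymbol g}$). Run Algorithm 2 with $\alpha=T^a$ and $\gamma^2=\frac{1}{2\beta^2}T^a$, where $a$ is a fixed exponent. Then $$\mathrm{Regret}\le O\big(\max\{T^aV_x,\ T^aV_{\boldsymbol g},\ T^{1-a}\}\big),\qquad \mathrm{Vio}_k\le O(1)\quad\text{for all }k=1,\dots,K.$$ In particular, with $\alpha=2\beta^2\gamma^2=\sqrt T$ the bounds become $\mathrm{Regret}\le O(\max\{\sqrt T\,V_x,\sqrt T\,V_{\boldsymbol g}\})$ and $\mathrm{Vio}_k\le O(1)$ for all $k$. Here $O(\cdot)$ is with respect to the time horizon $T$ and hides factors depending only on the constants $R,F,G,K,\epsilon,\bar V_{\boldsymbol g}$ of the standing assumptions.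
   Context: Setting. $\|\cdot\|$ is the Euclidean norm; vector inequalities and maxima are componentwise. $\chi\subseteq\mathbb R^n$ is nonempty, closed, convex; for $t=1,\dots,T$, $f_t:\chi\to\mathbb R$ is a loss function and $\boldsymbol g_t=(g_{t,1},\dots,g_{t,K})^T:\chi\to\mathbb R^K$ a vector of constraint functions; $x_t^*\in\arg\min\{f_t(x):x\in\chi,\boldsymbol g_t(x)\le\boldsymbol0\}$. Standing assumptions. (1) $\chi$ is compact with $\|x-y\|\le R$ for all $x,y\in\chi$; all $f_t$, $g_{t,k}$ are convex with $\max\{|f_t(x)|,\|\boldsymbol g_t(x)\|\}\le F$ on $\chi$; $\max\{\|\nabla f_t(x)\|,\|\nabla g_{t,k}(x)\|\}\le G$ for all $x\in\chi,k,t$; consequently, with $\beta:=KG$, $\|\boldsymbol g_t(x)-\boldsymbol g_t(y)\|\le\beta\|x-y\|$ on $\chi$. (2) Slater condition: there are $\epsilon>0$ and $\hat x\in\chi$ with $g_{t,k}(\hat x)\le-\epsilon$ for all $t,k$. (3) $\epsilon>\bar V_{\boldsymbol g}:=\max_{t}\max_{x\in\chi}\|\boldsymbol g_{t+1}(x)-\boldsymbol g_t(x)\|$. Algorithm 2 with parameters $\alpha,\gamma>0$. Initialize $\boldsymbol\lambda(0)=\boldsymbol0\in\mathbb R^K$, $x_1\in\chi$ arbitrary. For $t=1,\dots,T-1$: $$\boldsymbol\lambda(t)=\max\{\boldsymbol\lambda(t-1)+\gamma\boldsymbol g_t(x_t),\,-\gamma\boldsymbol g_t(x_t)\},$$ $$x_{t+1}=\arg\min_{x\in\chi}\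 \nabla f_t(x_t)^T(x-x_t)+[\boldsymbol\lambda(t)+\gamma\boldsymbol g_t(x_t)]^T(\gamma\boldsymbol g_t(x))+\alpha\|x-x_t\|^2 .$$ Performance measures. $\mathrm{Regret}=\sum_{t=1}^Tf_t(x_t)-\sum_{t=1}^Tf_t(x_t^* )$; $\mathrm{Vio}_k=\sum_{t=1}^Tg_{t,k}(x_t)$; $V_x=\sum_{t=2}^T\|x_t^*-x_{t-1}^*\|$; $V_{\boldsymbol g}=\sum_{t=2}^T\sup_{x\in\chi}\|\boldsymbol g_t(x)-\boldsymbol g_{t-1}(x)\|$.
   Formalization: Vio_k ≤ O(1) is stated only for a ≥ 0; the regret bound for a > 1/2 and the "in particular" regret bound are stated only when max{V_x,V_g} ≥ v > 0, with a hidden constant also depending on v. Without these restrictions the claims fail. *)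

theory Defs
  imports "HOL-Analysis.Analysis"
begin

text \<open>
  The constants hidden in \<open>O(\<cdot>)\<close> must not depend on the dimension \<open>n\<close> of the decision space, so
  \<open>n\<close> has to be quantified inside the formula, after these constants. The spaces \<open>\<real>\<^sup>n\<close> are
  therefore represented as the subspaces \<open>Rn n\<close> of one inner product space: the real sequences
  of finite support with the inner product \<open>\<Sum>i. x i * y i\<close>. On \<open>Rn n\<close> the inner product and the norm
  are the Euclidean ones (lemmas \<open>inner_Rn\<close> and \<open>norm_Rn\<close>).
\<close>

typedef finseq = "{x :: nat \<Rightarrow> real. finite {i. x i \<noteq> 0}}"
  morphisms coord Abs_finseq
  by (rule exI[of _ "\<lambda>_. 0"]) simp

setup_lifting type_definition_finseq

lemma finseq_eqI: "(\<And>i. coord x i = coord y i) \<Longrightarrow> x = y"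
  by (simp add: coord_inject[symmetric] fun_eq_iff)

lemma finite_coord [simp]: "finite {i. coord x i \<noteq> 0}"
  using coord[of x] by simp

instantiation finseq :: real_inner
begin

lift_definition zero_finseq :: finseq is "\<lambda>_. 0" by simp

lift_definition plus_finseq :: "finseq \<Rightarrow> finseq \<Rightarrow> finseq" is "\<lambda>x y i. x i + y i"
  by (erule (1) finite_subset[OF _ finite_UnI, rotated]) auto

lift_definition uminus_finseq :: "finseq \<Rightarrow> finseq" is "\<lambda>x i. - x i" by simp

lift_definition minus_finseq :: "finseq \<Rightarrow> finseq \<Rightarrow> finseq" is "\<lambda>x y i. x i - y i"
  by (erule (1) finite_subset[OF _ finite_UnI, rotated]) auto

lift_definition scaleR_finseq :: "real \<Rightarrow> finseq \<Rightarrow> finseq" is "\<lambda>r x i. r * x i"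
  by (rule finite_subset[rotated]) auto

definition inner_finseq :: "finseq \<Rightarrow> finseq \<Rightarrow> real" where
  "inner_finseq x y = (\<Sum>i | coord x i \<noteq> 0. coord x i * coord y i)"

definition norm_finseq :: "finseq \<Rightarrow> real" where
  "norm_finseq x = sqrt (inner x x)"

definition sgn_finseq :: "finseq \<Rightarrow> finseq" where
  "sgn_finseq x = inverse (norm x) *\<^sub>R x"

definition dist_finseq :: "finseq \<Rightarrow> finseq \<Rightarrow> real" where
  "dist_finseq x y = norm (x - y)"

definition uniformity_finseq :: "(finseq \<times> finseq) filter" where
  "uniformity_finseq = (INF e\<in>{0<..}. principal {(x, y). dist x y < e})"

definition open_finseq :: "finseq set \<Rightarrow> bool" where
  "open_finseq U \<longleftrightarrow> (\<forall>x\<in>U. \<forall>\<^sub>F (x', y) in uniformity. x' = x \<longrightarrow> y \<in> U)"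

instance
proof
  have inner_superset: "inner x y = (\<Sum>i\<in>A. coord x i * coord y i)"
    if "finite A" "{i. coord x i \<noteq> 0} \<subseteq> A" for x y :: finseq and A
    unfolding inner_finseq_def by (rule sum.mono_neutral_left) (use that in auto)
  fix x y z :: finseq and r s :: real
  let ?A = "{i. coord x i \<noteq> 0} \<union> {i. coord y i \<noteq> 0}"
  show "x + y + z = x + (y + z)" "x + y = y + x" "0 + x = x" "- x + x = 0" "x - y = x + - y"
    by (transfer; simp add: fun_eq_iff)+
  show "r *\<^sub>R (x + y) = r *\<^sub>R x + r *\<^sub>R y" "(r + s) *\<^sub>R x = r *\<^sub>R x + s *\<^sub>R x"
    "r *\<^sub>R s *\<^sub>R x = (r * s) *\<^sub>R x" "1 *\<^sub>R x = x"
    by (transfer; simp add: fun_eq_iff algebra_simps)+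
  show "sgn x = inverse (norm x) *\<^sub>R x" by (rule sgn_finseq_def)
  show "dist x y = norm (x - y)" by (rule dist_finseq_def)
  show "uniformity = (INF e\<in>{0<..}. principal {(x, y :: finseq). dist x y < e})"
    by (rule uniformity_finseq_def)
  show "open U = (\<forall>x\<in>U. \<forall>\<^sub>F (x', y) in uniformity. x' = x \<longrightarrow> y \<in> U)" for U :: "finseq set"
    by (rule open_finseq_def)
  show "inner x y = inner y x"
    using inner_superset[of ?A x y] inner_superset[of ?A y x] by (simp add: mult.commute)
  have "{i. coord (x + y) i \<noteq> 0} \<subseteq> ?A"
    by (auto simp: plus_finseq.rep_eq)
  then show "inner (x + y) z = inner x z + inner y z"
    using inner_superset[of ?A "x + y" z] inner_superset[of ?A x z] inner_superset[of ?A y z]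
    by (simp add: plus_finseq.rep_eq distrib_right sum.distrib)
  have "{i. coord (r *\<^sub>R x) i \<noteq> 0} \<subseteq> {i. coord x i \<noteq> 0}"
    by (auto simp: scaleR_finseq.rep_eq)
  then show "inner (r *\<^sub>R x) y = r * inner x y"
    using inner_superset[of "{i. coord x i \<noteq> 0}" "r *\<^sub>R x" y]
    by (simp add: inner_finseq_def scaleR_finseq.rep_eq sum_distrib_left mult.assoc)
  show "0 \<le> inner x x"
    by (simp add: inner_finseq_def sum_nonneg)
  show "inner x x = 0 \<longleftrightarrow> x = 0"
  proof
    assume "inner x x = 0"
    then have "\<forall>i\<in>{i. coord x i \<noteq> 0}. coord x i * coord x i = 0"
      unfolding inner_finseq_def by (subst (asm) sum_nonneg_eq_0_iff) auto
    then show "x = 0"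
      by (intro finseq_eqI) (auto simp: zero_finseq.rep_eq)
  qed (simp add: inner_finseq_def zero_finseq.rep_eq)
  show "norm x = sqrt (inner x x)" by (rule norm_finseq_def)
qed

end

definition Rn :: "nat \<Rightarrow> finseq set" where
  "Rn n = {x. \<forall>i\<ge>n. coord x i = 0}"

lemma inner_Rn: "x \<in> Rn n \<Longrightarrow> inner x y = (\<Sum>i<n. coord x i * coord y i)"
  unfolding inner_finseq_def Rn_def
  by (rule sum.mono_neutral_left) (auto simp: not_less[symmetric])

lemma norm_Rn: "x \<in> Rn n \<Longrightarrow> norm x = L2_set (coord x) {..<n}"
  by (simp add: norm_eq_sqrt_inner inner_Rn L2_set_def power2_eq_square)

lemma subspace_Rn: "subspace (Rn n)"
  by (auto simp: subspace_def Rn_def zero_finseq.rep_eq plus_finseq.rep_eq scaleR_finseq.rep_eq)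

text \<open>
  Losses and constraints are only given on the decision set \<open>S\<close>, so differentiability is taken
  within \<open>S\<close>. If \<open>S\<close> has empty interior in \<open>\<real>\<^sup>n\<close> the gradient need not be unique; gradients are
  therefore part of the data, and every admissible choice is allowed.
\<close>

definition is_gradient :: "nat \<Rightarrow> finseq set \<Rightarrow> (finseq \<Rightarrow> real) \<Rightarrow> finseq \<Rightarrow> finseq \<Rightarrow> bool" where
  "is_gradient n S f x v \<longleftrightarrow>
     v \<in> Rn n \<and> (f has_derivative (\<lambda>h. inner v h)) (at x within S)"

definition bounded_convex_problem ::
  "real \<Rightarrow> real \<Rightarrow> real \<Rightarrow> nat \<Rightarrow> nat \<Rightarrow> finseq set
   \<Rightarrow> (nat \<Rightarrow> finseq \<Rightarrow> real) \<Rightarrow> (nat \<Rightarrow> finseq \<Rightarrow> finseq)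
   \<Rightarrow> (nat \<Rightarrow> finseq \<Rightarrow> real^'k) \<Rightarrow> (nat \<Rightarrow> 'k \<Rightarrow> finseq \<Rightarrow> finseq) \<Rightarrow> bool" where
  "bounded_convex_problem R F G n T S f df g dg \<longleftrightarrow>
     S \<subseteq> Rn n \<and> S \<noteq> {} \<and> compact S \<and> convex S \<and>
     (\<forall>x\<in>S. \<forall>y\<in>S. norm (x - y) \<le> R) \<and>
     (\<forall>t\<in>{1..T}.
        convex_on S (f t) \<and>
        (\<forall>k. convex_on S (\<lambda>x. g t x $ k)) \<and>
        (\<forall>x\<in>S. max \<bar>f t x\<bar> (norm (g t x)) \<le> F) \<and>
        (\<forall>x\<in>S. is_gradient n S (f t) x (df t x) \<and> norm (df t x) \<le> G) \<and>
        (\<forall>k. \<forall>x\<in>S. is_gradient n S (\<lambda>y. g t y $ k) x (dg t k x) \<and> norm (dg t k x) \<le> G))"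

definition slater ::
  "real \<Rightarrow> nat \<Rightarrow> finseq set \<Rightarrow> (nat \<Rightarrow> finseq \<Rightarrow> real^'k) \<Rightarrow> bool" where
  "slater \<epsilon> T S g \<longleftrightarrow> 0 < \<epsilon> \<and> (\<exists>xh\<in>S. \<forall>t\<in>{1..T}. \<forall>k. g t xh $ k \<le> - \<epsilon>)"

definition step_variation ::
  "finseq set \<Rightarrow> (nat \<Rightarrow> finseq \<Rightarrow> real^'k) \<Rightarrow> nat \<Rightarrow> real" where
  "step_variation S g t = (SUP x\<in>S. norm (g (Suc t) x - g t x))"

text \<open>The supremum in \<open>step_variation\<close> is attained on a compact \<open>S\<close>. The element \<open>0\<close> only matters for
  \<open>T = 1\<close>, where the maximum would range over the empty set.\<close>

definition max_step_variation ::
  "nat \<Rightarrow> finseq set \<Rightarrow> (nat \<Rightarrow> finseq \<Rightarrow> real^'k) \<Rightarrow> real" where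
  "max_step_variation T S g = Max (insert 0 (step_variation S g ` {1..<T}))"

text \<open>On \<open>real^'k\<close> the order \<open>\<le>\<close> is componentwise.\<close>

definition offline_minimizers ::
  "nat \<Rightarrow> finseq set \<Rightarrow> (nat \<Rightarrow> finseq \<Rightarrow> real) \<Rightarrow> (nat \<Rightarrow> finseq \<Rightarrow> real^'k)
   \<Rightarrow> (nat \<Rightarrow> finseq) \<Rightarrow> bool" where
  "offline_minimizers T S f g xs \<longleftrightarrow>
     (\<forall>t\<in>{1..T}. is_arg_min (f t) (\<lambda>x. x \<in> S \<and> g t x \<le> 0) (xs t))"

definition algorithm_run ::
  "real \<Rightarrow> real \<Rightarrow> nat \<Rightarrow> finseq set
   \<Rightarrow> (nat \<Rightarrow> finseq \<Rightarrow> finseq) \<Rightarrow> (nat \<Rightarrow> finseq \<Rightarrow> real^'k)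
   \<Rightarrow> (nat \<Rightarrow> finseq) \<Rightarrow> (nat \<Rightarrow> real^'k) \<Rightarrow> bool" where
  "algorithm_run \<alpha> \<gamma> T S df g x lam \<longleftrightarrow>
     lam 0 = 0 \<and> x 1 \<in> S \<and>
     (\<forall>t\<in>{1..<T}.
        lam t = (\<chi> k. max (lam (t - 1) $ k + \<gamma> * g t (x t) $ k) (- \<gamma> * g t (x t) $ k)) \<and>
        is_arg_min
          (\<lambda>y. inner (df t (x t)) (y - x t)
               + inner (lam t + \<gamma> *\<^sub>R g t (x t)) (\<gamma> *\<^sub>R g t y)
               + \<alpha> * (norm (y - x t))\<^sup>2)
          (\<lambda>y. y \<in> S) (x (t + 1)))"

definition regret ::
  "nat \<Rightarrow> (nat \<Rightarrow> finseq \<Rightarrow> real) \<Rightarrow> (nat \<Rightarrow> finseq) \<Rightarrow> (nat \<Rightarrow> finseq) \<Rightarrow> real" where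
  "regret T f xs x = (\<Sum>t=1..T. f t (x t)) - (\<Sum>t=1..T. f t (xs t))"

definition violation ::
  "nat \<Rightarrow> (nat \<Rightarrow> finseq \<Rightarrow> real^'k) \<Rightarrow> (nat \<Rightarrow> finseq) \<Rightarrow> 'k \<Rightarrow> real" where
  "violation T g x k = (\<Sum>t=1..T. g t (x t) $ k)"

definition minimizer_variation :: "nat \<Rightarrow> (nat \<Rightarrow> finseq) \<Rightarrow> real" where
  "minimizer_variation T xs = (\<Sum>t=2..T. norm (xs t - xs (t - 1)))"

definition constraint_variation ::
  "nat \<Rightarrow> finseq set \<Rightarrow> (nat \<Rightarrow> finseq \<Rightarrow> real^'k) \<Rightarrow> real" where
  "constraint_variation T S g = (\<Sum>t=2..T. step_variation S g (t - 1))"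

end

theory Submission
  imports Defs
begin

text \<open>
  The objective of each update is \<open>2\<alpha>\<close>-strongly convex, so its minimizer satisfies a three-point
  inequality against every comparator \<open>y\<close> in the decision set. With \<open>y = xs t\<close> the constraint term of
  the comparator is nonpositive, and the choice of \<open>\<alpha>\<close> and \<open>\<gamma>\<close> lets \<open>\<alpha> (norm (x (t+1) - x t))\<^sup>2\<close>
  absorb the linearization errors of loss and constraints; what remains is controlled by the drift of
  \<open>(norm (lam t))\<^sup>2 / 2\<close>, and everything except the variation terms telescopes. With \<open>y\<close> the Slater point
  the same inequality gives a negative drift once the queue exceeds a threshold of order
  \<open>(1 + \<alpha>) / \<gamma> + \<gamma>\<close>, because the Slater gap \<open>\<epsilon>\<close> exceeds the per-step variation \<open>Vbar\<close>. Hence the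
  queue is bounded at that order, and it dominates \<open>\<gamma>\<close> times the accumulated violation.
\<close>

section \<open>Convexity\<close>

text \<open>Along the segment \<open>p\<close> from \<open>x\<close> to \<open>y\<close>, convexity
  bounds every difference quotient of \<open>f\<close> at 0 by \<open>f y - f x\<close>, and these
  quotients tend to \<open>f' (y - x)\<close>. The segment stays in \<open>S\<close>, so a
  derivative within \<open>S\<close> suffices.\<close>

lemma convex_on_ge_linearization:
  fixes f :: "'a::real_normed_vector \<Rightarrow> real"
  assumes f: "convex_on S f" and x: "x \<in> S" and y: "y \<in> S"
    and D: "(f has_derivative f') (at x within S)"
  shows "f x + f' (y - x) \<le> f y"
proof -
  have S: "convex S"
    using f by (rule convex_on_imp_convex)
  define p where "p s = x + s *\<^sub>R (y - x)" for s :: real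
  have p_conv: "p s = (1 - s) *\<^sub>R x + s *\<^sub>R y" for s
    by (simp add: p_def algebra_simps)
  have p_S: "p s \<in> S" if "s \<in> {0..1}" for s
    unfolding p_conv using S x y that by (auto simp: convex_def)
  have "(p has_derivative (\<lambda>s. s *\<^sub>R (y - x))) (at 0 within {0..1})"
    unfolding p_def by (auto intro!: derivative_eq_intros)
  moreover have "(f has_derivative f') (at (p 0) within p ` {0..1})"
    using D p_S by (auto intro: has_derivative_subset simp: p_def)
  ultimately have "((f \<circ> p) has_derivative (f' \<circ> (\<lambda>s. s *\<^sub>R (y - x)))) (at 0 within {0..1})"
    by (rule diff_chain_within)
  moreover have "f' \<circ> (\<lambda>s. s *\<^sub>R (y - x)) = (*) (f' (y - x))"
    using has_derivative_linear[OF D] by (auto simp: linear_scale)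
  ultimately have "((f \<circ> p) has_field_derivative f' (y - x)) (at 0 within {0..1})"
    by (simp add: has_field_derivative_def)
  then have lim: "((\<lambda>s. (f (p s) - f (p 0)) / s) \<longlongrightarrow> f' (y - x)) (at 0 within {0..1})"
    by (simp add: has_field_derivative_iff)
  have "f' (y - x) \<le> f y - f x"
  proof (rule tendsto_upperbound[OF lim])
    show "at 0 within {0..1::real} \<noteq> bot"
      by (simp add: at_within_Icc_at_right)
    have "(f (p s) - f (p 0)) / s \<le> f y - f x" if "s \<in> {0..1}" "s \<noteq> 0" for s
    proof -
      have "f (p s) \<le> (1 - s) * f x + s * f y"
        unfolding p_conv using f x y that by (intro convex_onD) auto
      with that show ?thesis
        by (simp add: p_def field_simps)
    qed
    then show "\<forall>\<^sub>F s in at 0 within {0..1}. (f (p s) - f (p 0)) / s \<le> f y - f x"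
      by (auto simp: eventually_at_filter)
  qed
  then show ?thesis
    by simp
qed

text \<open>Linearizing at each of the two points bounds the difference from both sides.\<close>

lemma convex_on_lipschitz:
  fixes f :: "'a::real_inner \<Rightarrow> real"
  assumes f: "convex_on S f" and "x \<in> S" "y \<in> S"
    and D: "\<And>z. z \<in> S \<Longrightarrow> (f has_derivative (\<lambda>h. inner (f' z) h)) (at z within S)"
    and G: "\<And>z. z \<in> S \<Longrightarrow> norm (f' z) \<le> G"
  shows "\<bar>f x - f y\<bar> \<le> G * norm (x - y)"
proof -
  have "f u - f v \<le> G * norm (u - v)" if "u \<in> S" "v \<in> S" for u v
  proof -
    have "f u + inner (f' u) (v - u) \<le> f v"
      by (rule convex_on_ge_linearization[OF f that D]) fact
    then have "f u - f v \<le> inner (f' u) (u - v)"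
      by (simp add: inner_diff_right)
    also have "\<dots> \<le> norm (f' u) * norm (u - v)"
      by (rule norm_cauchy_schwarz)
    also have "\<dots> \<le> G * norm (u - v)"
      using G that by (intro mult_right_mono) auto
    finally show ?thesis .
  qed
  from this[of x y] this[of y x] show ?thesis
    using assms by (simp add: abs_le_iff norm_minus_commute)
qed

text \<open>The exact form of the strong convexity of the squared norm.\<close>

lemma norm_convex_combination_squared:
  fixes u v :: "'a::real_inner"
  shows "(norm ((1 - s) *\<^sub>R u + s *\<^sub>R v))\<^sup>2 =
    (1 - s) * (norm u)\<^sup>2 + s * (norm v)\<^sup>2 - s * (1 - s) * (norm (v - u))\<^sup>2"
  by (simp add: power2_norm_eq_inner inner_add_left inner_add_right inner_diff_left inner_diff_right
      inner_commute algebra_simps)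

text \<open>Compare \<open>z\<close> with points between \<open>z\<close> and \<open>y\<close>,
  divide by \<open>s\<close> and let \<open>s\<close> tend to 0: strong convexity of the quadratic
  term leaves the gain \<open>\<alpha> * (norm (y - z))\<^sup>2\<close>.\<close>

lemma proximal_min_three_points:
  fixes h :: "'a::real_inner \<Rightarrow> real"
  assumes h: "convex_on S h"
    and min: "is_arg_min (\<lambda>y. h y + \<alpha> * (norm (y - c))\<^sup>2) (\<lambda>y. y \<in> S) z"
    and y: "y \<in> S"
  shows "h z + \<alpha> * (norm (z - c))\<^sup>2 \<le> h y + \<alpha> * (norm (y - c))\<^sup>2 - \<alpha> * (norm (y - z))\<^sup>2"
proof -
  have z: "z \<in> S" and le: "\<And>w. w \<in> S \<Longrightarrow> h z + \<alpha> * (norm (z - c))\<^sup>2 \<le> h w + \<alpha> * (norm (w - c))\<^sup>2"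
    using min by (auto simp: is_arg_min_linorder)
  have S: "convex S"
    using h by (rule convex_on_imp_convex)
  \<comment> \<open>What remains of the comparison after division by \<open>s\<close>; its value at
    0 is the claim.\<close>
  define q where "q s = h y + \<alpha> * (norm (y - c))\<^sup>2 - (1 - s) * (\<alpha> * (norm (y - z))\<^sup>2)" for s :: real
  have "h z + \<alpha> * (norm (z - c))\<^sup>2 \<le> q s" if s: "0 < s" "s < 1" for s
  proof -
    define w where "w = (1 - s) *\<^sub>R z + s *\<^sub>R y"
    have "w \<in> S"
      unfolding w_def using S y z s by (auto simp: convex_def)
    then have "h z + \<alpha> * (norm (z - c))\<^sup>2 \<le> h w + \<alpha> * (norm (w - c))\<^sup>2"
      by (rule le)
    also have "w - c = (1 - s) *\<^sub>R (z - c) + s *\<^sub>R (y - c)"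
      by (simp add: w_def algebra_simps)
    then have "(norm (w - c))\<^sup>2 =
        (1 - s) * (norm (z - c))\<^sup>2 + s * (norm (y - c))\<^sup>2 - s * (1 - s) * (norm (y - z))\<^sup>2"
      by (simp only: norm_convex_combination_squared) simp
    also have "h w \<le> (1 - s) * h z + s * h y"
      unfolding w_def using h y z s by (intro convex_onD) auto
    finally have "s * (h z + \<alpha> * (norm (z - c))\<^sup>2) \<le> s * q s"
      by (simp add: q_def algebra_simps)
    then show ?thesis
      using s by simp
  qed
  then have "\<forall>\<^sub>F s in at_right 0. h z + \<alpha> * (norm (z - c))\<^sup>2 \<le> q s"
    by (auto simp: eventually_at_right_field intro!: exI[of _ 1])
  moreover have "(q \<longlongrightarrow> q 0) (at_right 0)"
    unfolding q_def by (intro tendsto_intros)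
  ultimately have "h z + \<alpha> * (norm (z - c))\<^sup>2 \<le> q 0"
    by (intro tendsto_lowerbound) auto
  then show ?thesis
    by (simp add: q_def)
qed

lemma convex_on_nonneg_combination:
  fixes h :: "'i \<Rightarrow> 'a::real_vector \<Rightarrow> real"
  assumes "finite I" "convex S"
    and "\<And>i. i \<in> I \<Longrightarrow> 0 \<le> c i" "\<And>i. i \<in> I \<Longrightarrow> convex_on S (h i)"
  shows "convex_on S (\<lambda>y. \<Sum>i\<in>I. c i * h i y)"
  using assms
proof (induction I rule: finite_induct)
  case (insert i I)
  then have "convex_on S (\<lambda>y. c i * h i y + (\<Sum>i\<in>I. c i * h i y))"
    by (intro convex_on_add convex_on_cmul) auto
  with insert.hyps show ?case
    by simp
qed (simp add: convex_on_def)

section \<open>Virtual queues\<close>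

definition queue_update :: "real^'k \<Rightarrow> real^'k \<Rightarrow> real^'k" where
  "queue_update q u = (\<chi> k. max (q $ k + u $ k) (- u $ k))"

text \<open>The second inequality makes the constraint weights in the primal update nonnegative,
  hence its objective convex.\<close>

lemma queue_update_nonneg:
  assumes "0 \<le> q"
  shows "0 \<le> queue_update q u" and "0 \<le> queue_update q u + u"
  using assms by (auto simp: queue_update_def less_eq_vec_def max_def) (smt (verit))+

text \<open>The entry \<open>- u $ k\<close> of the maximum covers negative \<open>u $ k\<close>,
  the other entry covers the rest. This later keeps the potential nonnegative.\<close>

lemma norm_queue_update_ge:
  assumes "0 \<le> q"
  shows "norm u \<le> norm (queue_update q u)"
proof (rule norm_le_componentwise_cart)
  fix k
  have "0 \<le> q $ k"
    using assms by (simp add: less_eq_vec_def)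
  then show "norm (u $ k) \<le> norm (queue_update q u $ k)"
    by (auto simp: queue_update_def max_def)
qed

lemma norm_queue_update_le:
  fixes q u :: "real^'k"
  assumes "0 \<le> q"
  shows "norm (queue_update q u) \<le> norm q + norm u"
proof -
  have "norm (queue_update q u) \<le> norm (q + (\<chi> k. \<bar>u $ k\<bar>))"
  proof (rule norm_le_componentwise_cart)
    fix k
    have "0 \<le> q $ k"
      using assms by (simp add: less_eq_vec_def)
    then show "norm (queue_update q u $ k) \<le> norm ((q + (\<chi> k. \<bar>u $ k\<bar>)) $ k)"
      by (auto simp: queue_update_def max_def)
  qed
  also have "\<dots> \<le> norm q + norm (\<chi> k. \<bar>u $ k\<bar>)"
    by (rule norm_triangle_ineq)
  also have "norm (\<chi> k. \<bar>u $ k\<bar>) = norm u"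
    by (simp add: norm_vec_def)
  finally show ?thesis .
qed

text \<open>Coordinatewise, twice the right-hand side plus the old square is (q + u)^2 + u^2, which
  dominates the square of either entry of the maximum.\<close>

lemma queue_update_drift:
  fixes q u :: "real^'k"
  shows "(norm (queue_update q u))\<^sup>2 / 2 - (norm q)\<^sup>2 / 2 \<le> inner q u + (norm u)\<^sup>2"
proof -
  have *: "(max (a + b) (- b))\<^sup>2 \<le> a\<^sup>2 + 2 * (a * b) + 2 * b\<^sup>2" for a b :: real
  proof -
    have "0 \<le> b\<^sup>2" "0 \<le> (a + b)\<^sup>2"
      by simp_all
    then show ?thesis
      by (auto simp: max_def power2_eq_square algebra_simps)
  qed
  have "(norm (queue_update q u))\<^sup>2 = (\<Sum>k\<in>UNIV. (max (q $ k + u $ k) (- u $ k))\<^sup>2)"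
    unfolding power2_norm_eq_inner inner_vec_def by (simp add: queue_update_def power2_eq_square)
  also have "\<dots> \<le> (\<Sum>k\<in>UNIV. (q $ k)\<^sup>2 + 2 * (q $ k * u $ k) + 2 * (u $ k)\<^sup>2)"
    by (intro sum_mono) (use * in auto)
  also have "\<dots> = (norm q)\<^sup>2 + 2 * inner q u + 2 * (norm u)\<^sup>2"
    unfolding power2_norm_eq_inner inner_vec_def
    by (simp add: power2_eq_square sum.distrib sum_distrib_left)
  finally show ?thesis
    by simp
qed


text \<open>Only the coupling \<open>steps\<close> of the two step sizes is fixed here. It holds for
  every exponent \<open>a\<close> and for the square-root choice, so the exponent enters at the very
  end. \<open>lam_T\<close> extends the queue recursion to the last round, so that the queue also
  accounts for the violation there.\<close>

locale virtual_queue_run =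
  fixes R F G \<epsilon> Vbar \<alpha> \<gamma> :: real and n T :: nat
    and S :: "finseq set" and f :: "nat \<Rightarrow> finseq \<Rightarrow> real" and df :: "nat \<Rightarrow> finseq \<Rightarrow> finseq"
    and g :: "nat \<Rightarrow> finseq \<Rightarrow> real^'k" and dg :: "nat \<Rightarrow> 'k \<Rightarrow> finseq \<Rightarrow> finseq"
    and xs x :: "nat \<Rightarrow> finseq" and lam :: "nat \<Rightarrow> real^'k"
  assumes T_pos: "1 \<le> T" and \<alpha>_pos: "0 < \<alpha>" and \<gamma>_pos: "0 < \<gamma>" and G_pos: "0 < G"
    and Vbar_less: "Vbar < \<epsilon>"
    and prob: "bounded_convex_problem R F G n T S f df g dg"
    and slater: "slater \<epsilon> T S g"
    and Vbar: "max_step_variation T S g = Vbar"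
    and xs: "offline_minimizers T S f g xs"
    and run: "algorithm_run \<alpha> \<gamma> T S df g x lam"
    and lam_T: "lam T = queue_update (lam (T - 1)) (\<gamma> *\<^sub>R g T (x T))"
    and steps: "2 * (real CARD('k) * G)\<^sup>2 * \<gamma>\<^sup>2 = \<alpha>"
begin

section \<open>Consequences of the standing assumptions along a run\<close>

lemma diam: "u \<in> S \<Longrightarrow> v \<in> S \<Longrightarrow> norm (u - v) \<le> R"
  and S_ne: "S \<noteq> {}"
  using prob by (auto simp: bounded_convex_problem_def)

lemma
  assumes "t \<in> {1..T}"
  shows f_convex: "convex_on S (f t)"
    and g_convex: "convex_on S (\<lambda>x. g t x $ k)"
    and f_bound: "u \<in> S \<Longrightarrow> \<bar>f t u\<bar> \<le> F"
    and g_bound: "u \<in> S \<Longrightarrow> norm (g t u) \<le> F"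
    and df: "u \<in> S \<Longrightarrow> (f t has_derivative (\<lambda>h. inner (df t u) h)) (at u within S)"
    and df_bound: "u \<in> S \<Longrightarrow> norm (df t u) \<le> G"
    and dg: "u \<in> S \<Longrightarrow> ((\<lambda>y. g t y $ k) has_derivative (\<lambda>h. inner (dg t k u) h)) (at u within S)"
    and dg_bound: "u \<in> S \<Longrightarrow> norm (dg t k u) \<le> G"
  using prob assms unfolding bounded_convex_problem_def is_gradient_def by auto

lemma R_nonneg: "0 \<le> R"
  using S_ne diam by fastforce

lemma F_nonneg: "0 \<le> F"
  using S_ne f_bound[of 1] T_pos by fastforce

lemma Vbar_nonneg: "0 \<le> Vbar"
  unfolding Vbar[symmetric] max_step_variation_def by (rule Max_ge) auto

lemma step_variation_le_Vbar: "t \<in> {1..<T} \<Longrightarrow> step_variation S g t \<le> Vbar"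
  unfolding Vbar[symmetric] max_step_variation_def by (rule Max_ge) auto

lemma g_variation:
  assumes "t \<in> {1..<T}" "u \<in> S"
  shows "norm (g (Suc t) u - g t u) \<le> step_variation S g t"
  unfolding step_variation_def
proof (rule cSUP_upper[OF assms(2)])
  show "bdd_above ((\<lambda>x. norm (g (Suc t) x - g t x)) ` S)"
  proof (rule bdd_aboveI2)
    fix u assume "u \<in> S"
    then have "norm (g (Suc t) u) \<le> F" "norm (g t u) \<le> F"
      using assms by (auto intro!: g_bound)
    then show "norm (g (Suc t) u - g t u) \<le> F + F"
      using norm_triangle_ineq4[of "g (Suc t) u" "g t u"] by linarith
  qed
qed

lemma step_variation_nonneg: "t \<in> {1..<T} \<Longrightarrow> 0 \<le> step_variation S g t"
  using S_ne g_variation order_trans[OF norm_ge_zero] by blast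

text \<open>The detour through the l1 norm is the source of the factor \<open>CARD('k)\<close> in
  \<beta>.\<close>

lemma g_lipschitz:
  assumes "t \<in> {1..T}" "u \<in> S" "v \<in> S"
  shows "norm (g t u - g t v) \<le> real CARD('k) * G * norm (u - v)"
proof -
  have "norm (g t u - g t v) \<le> (\<Sum>k\<in>UNIV. \<bar>(g t u - g t v) $ k\<bar>)"
    by (rule norm_le_l1_cart)
  also have "\<dots> \<le> (\<Sum>k\<in>(UNIV :: 'k set). G * norm (u - v))"
  proof (rule sum_mono)
    fix k
    have "\<bar>g t u $ k - g t v $ k\<bar> \<le> G * norm (u - v)"
      by (rule convex_on_lipschitz[OF g_convex]) (use assms dg dg_bound in auto)
    then show "\<bar>(g t u - g t v) $ k\<bar> \<le> G * norm (u - v)"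
      by simp
  qed
  finally show ?thesis
    by (simp add: mult.assoc)
qed

lemma xs_S: "t \<in> {1..T} \<Longrightarrow> xs t \<in> S"
  and xs_feasible: "t \<in> {1..T} \<Longrightarrow> g t (xs t) \<le> 0"
  using xs by (auto simp: offline_minimizers_def is_arg_min_def)

lemma x_S:
  assumes "t \<in> {1..T}"
  shows "x t \<in> S"
proof (cases "t = 1")
  case False
  then have "t - 1 \<in> {1..<T}" "t = t - 1 + 1"
    using assms by auto
  then show ?thesis
    using run unfolding algorithm_run_def is_arg_min_def by metis
qed (use run in \<open>auto simp: algorithm_run_def\<close>)

section \<open>The queue recursion along a run\<close>

lemma lam_0: "lam 0 = 0"
  using run by (simp add: algorithm_run_def)

lemma lam_rec:
  assumes "t \<in> {1..T}"
  shows "lam t = queue_update (lam (t - 1)) (\<gamma> *\<^sub>R g t (x t))"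
proof (cases "t = T")
  case False
  then show ?thesis
    using run assms by (auto simp: algorithm_run_def queue_update_def)
qed (use lam_T in simp)

lemma lam_nonneg: "t \<le> T \<Longrightarrow> 0 \<le> lam t"
proof (induction t)
  case (Suc t)
  then show ?case
    using lam_rec[of "Suc t"] queue_update_nonneg(1) by auto
qed (simp add: lam_0)

lemma weights_nonneg:
  assumes "t \<in> {1..T}"
  shows "0 \<le> lam t + \<gamma> *\<^sub>R g t (x t)"
  unfolding lam_rec[OF assms] using assms by (intro queue_update_nonneg lam_nonneg) auto

lemma norm_scaled_g_le:
  assumes "t \<in> {1..T}"
  shows "\<gamma> * norm (g t (x t)) \<le> norm (lam t)"
  using norm_queue_update_ge[of "lam (t - 1)" "\<gamma> *\<^sub>R g t (x t)"] lam_nonneg[of "t - 1"]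
    lam_rec[OF assms] assms \<gamma>_pos by auto

text \<open>The upper and lower bounds for a queue update meet because the queue starts at 0.
  Thereby the queue part of the initial potential vanishes.\<close>

lemma norm_lam_1: "norm (lam 1) = \<gamma> * norm (g 1 (x 1))"
proof (rule antisym)
  show "norm (lam 1) \<le> \<gamma> * norm (g 1 (x 1))"
    using norm_queue_update_le[of "lam 0" "\<gamma> *\<^sub>R g 1 (x 1)"] lam_rec[of 1] lam_0 T_pos \<gamma>_pos by auto
qed (use norm_scaled_g_le T_pos in auto)

lemma norm_lam_Suc_le:
  assumes "t \<in> {1..<T}"
  shows "norm (lam (Suc t)) \<le> norm (lam t) + \<gamma> * F"
proof -
  have "norm (lam (Suc t)) \<le> norm (lam t) + norm (\<gamma> *\<^sub>R g (Suc t) (x (Suc t)))"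
    using lam_rec[of "Suc t"] lam_nonneg[of t] assms
      norm_queue_update_le[of "lam t" "\<gamma> *\<^sub>R g (Suc t) (x (Suc t))"] by auto
  also have "\<dots> \<le> norm (lam t) + \<gamma> * F"
    using g_bound[of "Suc t" "x (Suc t)"] x_S[of "Suc t"] assms \<gamma>_pos by auto
  finally show ?thesis .
qed

text \<open>The queue at \<open>Suc t\<close> is driven by \<open>g (Suc t)\<close>, while the
  update producing \<open>x (Suc t)\<close> only knows \<open>g t\<close>; exchanging the two costs
  the term with \<open>step_variation\<close>.\<close>

lemma drift:
  assumes "t \<in> {1..<T}"
  shows "(norm (lam (Suc t)))\<^sup>2 / 2 - (norm (lam t))\<^sup>2 / 2 \<le>
    \<gamma> * inner (lam t) (g t (x (Suc t))) + \<gamma> * norm (lam t) * step_variation S g t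
      + \<gamma>\<^sup>2 * (norm (g (Suc t) (x (Suc t))))\<^sup>2"
proof -
  have S: "x (Suc t) \<in> S"
    using assms by (intro x_S) auto
  have "inner (lam t) (g (Suc t) (x (Suc t)) - g t (x (Suc t)))
      \<le> norm (lam t) * norm (g (Suc t) (x (Suc t)) - g t (x (Suc t)))"
    by (rule norm_cauchy_schwarz)
  also have "\<dots> \<le> norm (lam t) * step_variation S g t"
    using g_variation[OF assms S] by (intro mult_left_mono) auto
  finally have "\<gamma> * inner (lam t) (g (Suc t) (x (Suc t)))
      \<le> \<gamma> * (inner (lam t) (g t (x (Suc t))) + norm (lam t) * step_variation S g t)"
    using \<gamma>_pos by (intro mult_left_mono) (auto simp: inner_diff_right)
  moreover have "(norm (lam (Suc t)))\<^sup>2 / 2 - (norm (lam t))\<^sup>2 / 2 \<le>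
      \<gamma> * inner (lam t) (g (Suc t) (x (Suc t))) + \<gamma>\<^sup>2 * (norm (g (Suc t) (x (Suc t))))\<^sup>2"
    using queue_update_drift[of "lam t" "\<gamma> *\<^sub>R g (Suc t) (x (Suc t))"] lam_rec[of "Suc t"] assms
    by (simp add: power_mult_distrib)
  ultimately show ?thesis
    by (simp add: algebra_simps)
qed

text \<open>With nonnegative weights, the linearized loss plus the weighted constraints is convex,
  so the three-point inequality applies with center \<open>x t\<close>.\<close>

lemma descent:
  assumes t: "t \<in> {1..<T}" and y: "y \<in> S"
  shows "inner (df t (x t)) (x (Suc t) - x t)
      + \<gamma> * inner (lam t + \<gamma> *\<^sub>R g t (x t)) (g t (x (Suc t))) + \<alpha> * (norm (x (Suc t) - x t))\<^sup>2
    \<le> inner (df t (x t)) (y - x t)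
      + \<gamma> * inner (lam t + \<gamma> *\<^sub>R g t (x t)) (g t y)
      + \<alpha> * (norm (y - x t))\<^sup>2 - \<alpha> * (norm (y - x (Suc t)))\<^sup>2"
proof -
  define w where "w = lam t + \<gamma> *\<^sub>R g t (x t)"
  define h where "h y = inner (df t (x t)) (y - x t) + inner w (\<gamma> *\<^sub>R g t y)" for y
  have w: "0 \<le> w $ k" for k
    using weights_nonneg[of t] t by (simp add: w_def less_eq_vec_def)
  have S: "convex S"
    using prob by (simp add: bounded_convex_problem_def)
  have "convex_on S (\<lambda>y. inner (df t (x t)) (y - x t))"
    using S by (intro convex_onI) (auto simp: inner_simps algebra_simps)
  moreover have "convex_on S (\<lambda>y. \<Sum>k\<in>UNIV. (\<gamma> * w $ k) * g t y $ k)"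
    using S w \<gamma>_pos t by (intro convex_on_nonneg_combination g_convex) auto
  ultimately have "convex_on S (\<lambda>y. inner (df t (x t)) (y - x t) + (\<Sum>k\<in>UNIV. (\<gamma> * w $ k) * g t y $ k))"
    by (rule convex_on_add)
  also have "(\<lambda>y. inner (df t (x t)) (y - x t) + (\<Sum>k\<in>UNIV. (\<gamma> * w $ k) * g t y $ k)) = h"
    unfolding h_def fun_eq_iff by (simp add: inner_vec_def mult_ac sum_distrib_left)
  finally have "convex_on S h" .
  moreover have "is_arg_min (\<lambda>y. h y + \<alpha> * (norm (y - x t))\<^sup>2) (\<lambda>y. y \<in> S) (x (Suc t))"
    using run t unfolding algorithm_run_def h_def w_def Suc_eq_plus1 by blast
  ultimately have "h (x (Suc t)) + \<alpha> * (norm (x (Suc t) - x t))\<^sup>2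
      \<le> h y + \<alpha> * (norm (y - x t))\<^sup>2 - \<alpha> * (norm (y - x (Suc t)))\<^sup>2"
    by (rule proximal_min_three_points) fact
  then show ?thesis
    by (simp add: h_def w_def)
qed

subsection \<open>Queue bound and constraint violation\<close>

text \<open>At the Slater point the weighted constraints contribute -\<epsilon> per unit of queue
  norm, while the change of the constraints costs at most \<open>Vbar\<close> per unit. The term
  \<open>\<epsilon> * F\<close> pays for replacing the weights by \<open>lam t\<close> in that
  contribution; of the two \<open>F\<^sup>2\<close>, one pays for the same replacement at
  \<open>x (Suc t)\<close>, the other for the quadratic term of \<open>drift\<close>.\<close>

lemma slater_drift:
  assumes t: "t \<in> {1..<T}"
  shows "(norm (lam (Suc t)))\<^sup>2 / 2 - (norm (lam t))\<^sup>2 / 2 \<le>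
    G * R + \<alpha> * R\<^sup>2 + \<gamma>\<^sup>2 * (\<epsilon> * F + 2 * F\<^sup>2) - \<gamma> * (\<epsilon> - Vbar) * norm (lam t)"
proof -
  obtain z where z: "z \<in> S" and z_le: "\<And>k. g t z $ k \<le> - \<epsilon>" and \<epsilon>: "0 < \<epsilon>"
    using slater t unfolding slater_def by fastforce
  have S: "x t \<in> S" "x (Suc t) \<in> S"
    using t by (auto intro!: x_S)
  let ?w = "lam t + \<gamma> *\<^sub>R g t (x t)"
  have g_le: "norm (g t (x t)) \<le> F" "norm (g t (x (Suc t))) \<le> F" "norm (g (Suc t) (x (Suc t))) \<le> F"
    using t S by (auto intro!: g_bound)
  \<comment> \<open>The l1 norm of the nonnegative weights is their sum, and this sum can be paired
    with the componentwise Slater inequality.\<close>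
  have "norm ?w \<le> (\<Sum>k\<in>UNIV. \<bar>?w $ k\<bar>)"
    by (rule norm_le_l1_cart)
  then have "\<epsilon> * norm ?w \<le> (\<Sum>k\<in>UNIV. ?w $ k * \<epsilon>)"
    using \<epsilon> weights_nonneg[of t] t
    by (simp add: less_eq_vec_def mult.commute[of _ \<epsilon>] flip: sum_distrib_left)
  also have "\<dots> \<le> (\<Sum>k\<in>UNIV. ?w $ k * - g t z $ k)"
  proof (intro sum_mono mult_left_mono)
    fix k
    show "\<epsilon> \<le> - g t z $ k"
      using z_le[of k] by simp
    show "0 \<le> ?w $ k"
      using weights_nonneg[of t] t by (simp add: less_eq_vec_def)
  qed
  finally have inner_z: "inner ?w (g t z) \<le> - \<epsilon> * norm ?w"
    by (simp add: inner_vec_def sum_negf)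
  have "norm (lam t) \<le> norm ?w + norm (\<gamma> *\<^sub>R g t (x t))"
    using norm_triangle_ineq4[of ?w "\<gamma> *\<^sub>R g t (x t)"] by simp
  also have "\<dots> \<le> norm ?w + \<gamma> * F"
    using g_le \<gamma>_pos by simp
  finally have "\<epsilon> * (norm (lam t) - \<gamma> * F) \<le> \<epsilon> * norm ?w"
    using \<epsilon> by simp
  with inner_z have "inner ?w (g t z) \<le> - \<epsilon> * (norm (lam t) - \<gamma> * F)"
    by simp
  then have 1: "\<gamma> * inner ?w (g t z) \<le> \<gamma> * (- \<epsilon> * (norm (lam t) - \<gamma> * F))"
    using \<gamma>_pos by (intro mult_left_mono) auto
  \<comment> \<open>The two gradient terms of \<open>descent\<close> are merged before estimating,
    so \<open>x t\<close> cancels and one diameter suffices.\<close>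
  have "inner (df t (x t)) (z - x (Suc t)) \<le> norm (df t (x t)) * norm (z - x (Suc t))"
    by (rule norm_cauchy_schwarz)
  also have "\<dots> \<le> G * R"
    using df_bound[of t "x t"] diam[of z "x (Suc t)"] z S t G_pos by (intro mult_mono) auto
  finally have 2: "inner (df t (x t)) (z - x t) - inner (df t (x t)) (x (Suc t) - x t) \<le> G * R"
    by (simp add: inner_diff_right)
  have "- inner (g t (x t)) (g t (x (Suc t))) \<le> norm (g t (x t)) * norm (g t (x (Suc t)))"
    using Cauchy_Schwarz_ineq2[of "g t (x t)" "g t (x (Suc t))"] by linarith
  also have "\<dots> \<le> F * F"
    using g_le F_nonneg by (intro mult_mono) auto
  finally have 3: "\<gamma>\<^sup>2 * - inner (g t (x t)) (g t (x (Suc t))) \<le> \<gamma>\<^sup>2 * (F * F)"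
    by (intro mult_left_mono) auto
  have 4: "\<gamma>\<^sup>2 * (norm (g (Suc t) (x (Suc t))))\<^sup>2 \<le> \<gamma>\<^sup>2 * F\<^sup>2"
    using g_le by (intro mult_left_mono power_mono) auto
  have 5: "\<gamma> * norm (lam t) * step_variation S g t \<le> \<gamma> * norm (lam t) * Vbar"
    using step_variation_le_Vbar[OF t] \<gamma>_pos by (intro mult_left_mono) auto
  have 6: "\<alpha> * (norm (z - x t))\<^sup>2 \<le> \<alpha> * R\<^sup>2"
    using diam[OF z S(1)] \<alpha>_pos by (intro mult_left_mono power_mono) auto
  have 7: "0 \<le> \<alpha> * (norm (z - x (Suc t)))\<^sup>2" "0 \<le> \<alpha> * (norm (x (Suc t) - x t))\<^sup>2"
    using \<alpha>_pos by auto
  have "\<gamma> * inner (lam t) (g t (x (Suc t)))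
      = \<gamma> * inner ?w (g t (x (Suc t))) + \<gamma>\<^sup>2 * - inner (g t (x t)) (g t (x (Suc t)))"
    by (simp add: inner_add_left power2_eq_square algebra_simps)
  also have "\<dots> \<le> \<gamma> * (- \<epsilon> * (norm (lam t) - \<gamma> * F)) + G * R + \<alpha> * R\<^sup>2 + \<gamma>\<^sup>2 * (F * F)"
    using descent[OF t z] 1 2 3 6 7 by linarith
  finally show ?thesis
    using drift[OF t] 4 5 by (simp add: power2_eq_square algebra_simps)
qed

text \<open>The quotient is the queue norm from which on the bound in \<open>slater_drift\<close> is
  nonpositive; \<open>\<gamma> * F\<close> bounds one jump from below that threshold.\<close>

definition queue_bound :: real where
  "queue_bound = (G * R + \<alpha> * R\<^sup>2 + \<gamma>\<^sup>2 * (\<epsilon> * F + 2 * F\<^sup>2)) / (\<gamma> * (\<epsilon> - Vbar)) + \<gamma> * F"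

text \<open>Above the threshold the norm cannot grow; from below it, one step adds at most
  \<open>\<gamma> * F\<close>.\<close>

lemma norm_lam_le:
  assumes "t \<in> {1..T}"
  shows "norm (lam t) \<le> queue_bound"
  using assms
proof (induction t)
  case (Suc t)
  let ?N = "G * R + \<alpha> * R\<^sup>2 + \<gamma>\<^sup>2 * (\<epsilon> * F + 2 * F\<^sup>2)"
  let ?d = "\<gamma> * (\<epsilon> - Vbar)"
  have d: "0 < ?d"
    using \<gamma>_pos Vbar_less by simp
  show ?case
  \<comment> \<open>The claim begins at time 1, so its base case sits inside the induction
    step.\<close>
  proof (cases "t = 0")
    case True
    have "0 \<le> ?N"
      using G_pos R_nonneg F_nonneg \<alpha>_pos Vbar_nonneg Vbar_less
      by (intro add_nonneg_nonneg mult_nonneg_nonneg) auto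
    then have "0 \<le> ?N / ?d"
      using d by simp
    moreover have "\<gamma> * norm (g 1 (x 1)) \<le> \<gamma> * F"
      using g_bound[of 1 "x 1"] x_S[of 1] T_pos \<gamma>_pos by auto
    ultimately show ?thesis
      using True norm_lam_1 unfolding queue_bound_def by simp
  next
    case False
    then have t: "t \<in> {1..<T}" "norm (lam t) \<le> queue_bound"
      using Suc by auto
    show ?thesis
    proof (cases "norm (lam t) \<le> ?N / ?d")
      case True
      then show ?thesis
        using norm_lam_Suc_le[OF t(1)] unfolding queue_bound_def by linarith
    next
      case False
      then have "?N \<le> ?d * norm (lam t)"
        using d by (simp add: field_simps)
      then have "(norm (lam (Suc t)))\<^sup>2 \<le> (norm (lam t))\<^sup>2"
        using slater_drift[OF t(1)] by linarith
      then have "norm (lam (Suc t)) \<le> norm (lam t)"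
        by (rule power2_le_imp_le) auto
      then show ?thesis
        using t(2) by linarith
    qed
  qed
qed simp

text \<open>By the first entry of the maximum, each round adds at least \<gamma> times the
  constraint value to the queue, so \<open>lam T\<close> dominates the scaled sum.\<close>

lemma violation_le: "violation T g x k \<le> queue_bound / \<gamma>"
proof -
  have "\<gamma> * (\<Sum>s=1..t. g s (x s) $ k) \<le> lam t $ k" if "t \<le> T" for t
    using that
  proof (induction t)
    case (Suc t)
    then have "\<gamma> * (\<Sum>s=1..Suc t. g s (x s) $ k) \<le> lam t $ k + \<gamma> * g (Suc t) (x (Suc t)) $ k"
      by (simp add: algebra_simps)
    also have "\<dots> \<le> lam (Suc t) $ k"
      using lam_rec[of "Suc t"] Suc by (simp add: queue_update_def)
    finally show ?case .
  qed (simp add: lam_0)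
  then have "\<gamma> * violation T g x k \<le> lam T $ k"
    by (simp add: violation_def)
  also have "\<dots> \<le> norm (lam T)"
    using component_le_norm_cart[of "lam T" k] by linarith
  also have "\<dots> \<le> queue_bound"
    using norm_lam_le T_pos by auto
  finally show ?thesis
    using \<gamma>_pos by (simp add: field_simps)
qed

subsection \<open>Regret\<close>

text \<open>A Lyapunov function: queue energy plus squared distance to the comparator. The
  subtracted constraint term is what telescopes from the polarization in
  \<open>regret_step\<close>.\<close>

definition potential :: "nat \<Rightarrow> real" where
  "potential t = (norm (lam t))\<^sup>2 / 2 - \<gamma>\<^sup>2 * (norm (g t (x t)))\<^sup>2 / 2 + \<alpha> * (norm (xs t - x t))\<^sup>2"

lemma potential_nonneg:
  assumes "t \<in> {1..T}"
  shows "0 \<le> potential t"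
proof -
  have "(\<gamma> * norm (g t (x t)))\<^sup>2 \<le> (norm (lam t))\<^sup>2"
    using norm_scaled_g_le[OF assms] \<gamma>_pos by (intro power_mono) auto
  then show ?thesis
    using \<alpha>_pos by (simp add: potential_def power_mult_distrib)
qed

lemma potential_1_le: "potential 1 \<le> \<alpha> * R\<^sup>2"
proof -
  have "xs 1 \<in> S" "x 1 \<in> S"
    using T_pos by (auto intro!: xs_S x_S)
  then have "(norm (xs 1 - x 1))\<^sup>2 \<le> R\<^sup>2"
    using diam by (intro power_mono) auto
  then show ?thesis
    using \<alpha>_pos unfolding potential_def norm_lam_1 by (simp add: power_mult_distrib)
qed

text \<open>\<open>descent\<close> with comparator \<open>xs t\<close> is combined with
  \<open>drift\<close>. The linearization errors of loss and constraints each consume a quarter of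
  \<open>\<alpha> * (norm (x (Suc t) - x t))\<^sup>2\<close>.\<close>

lemma regret_step:
  assumes t: "t \<in> {1..<T}"
  shows "f t (x t) - f t (xs t) \<le> G\<^sup>2 / \<alpha>
    + (\<gamma>\<^sup>2 * F + \<gamma> * queue_bound) * step_variation S g t
    + 2 * \<alpha> * R * norm (xs (Suc t) - xs t) + (potential t - potential (Suc t))"
proof -
  have S: "x t \<in> S" "x (Suc t) \<in> S" "xs t \<in> S" "xs (Suc t) \<in> S"
    using t by (auto intro!: x_S xs_S)
  let ?d = "norm (x (Suc t) - x t)"
  let ?w = "lam t + \<gamma> *\<^sub>R g t (x t)"
  let ?v = "step_variation S g t"
  have g_le: "norm (g t (x (Suc t))) \<le> F" "norm (g (Suc t) (x (Suc t))) \<le> F"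
    using t S by (auto intro!: g_bound)
  have 1: "f t (x t) + inner (df t (x t)) (xs t - x t) \<le> f t (xs t)"
    using t S by (intro convex_on_ge_linearization[OF f_convex] df) auto
  have "inner ?w (g t (xs t)) \<le> 0"
    unfolding inner_vec_def
    using weights_nonneg[of t] xs_feasible[of t] t
    by (intro sum_nonpos) (auto simp: less_eq_vec_def mult_nonneg_nonpos)
  then have 2: "\<gamma> * inner ?w (g t (xs t)) \<le> 0"
    using \<gamma>_pos by (simp add: mult_nonneg_nonpos)
  have "- inner (df t (x t)) (x (Suc t) - x t) \<le> norm (df t (x t)) * ?d"
    using Cauchy_Schwarz_ineq2[of "df t (x t)" "x (Suc t) - x t"] by linarith
  also have "\<dots> \<le> G * ?d"
    using df_bound[of t "x t"] t S by (intro mult_right_mono) auto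
  \<comment> \<open>Young's inequality, weighted to use up only a quarter of the proximal
    term.\<close>
  also have "\<dots> \<le> G\<^sup>2 / \<alpha> + \<alpha> * ?d\<^sup>2 / 4"
  proof -
    have "0 \<le> (G - \<alpha> * ?d / 2)\<^sup>2 / \<alpha>"
      using \<alpha>_pos by simp
    also have "\<dots> = G\<^sup>2 / \<alpha> + \<alpha> * ?d\<^sup>2 / 4 - G * ?d"
      using \<alpha>_pos by (simp add: power2_eq_square field_simps)
    finally show ?thesis
      by simp
  qed
  finally have 3: "- inner (df t (x t)) (x (Suc t) - x t) \<le> G\<^sup>2 / \<alpha> + \<alpha> * ?d\<^sup>2 / 4" .
  \<comment> \<open>Polarization: expanding this square produces the inner product of successive
    constraint values, and \<open>steps\<close> turns the Lipschitz bound into half of the proximal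
    term.\<close>
  have "(norm (g t (x (Suc t)) - g t (x t)))\<^sup>2 \<le> (real CARD('k) * G * ?d)\<^sup>2"
    using g_lipschitz t S by (intro power_mono) auto
  then have "\<gamma>\<^sup>2 * (norm (g t (x (Suc t)) - g t (x t)))\<^sup>2 \<le> \<gamma>\<^sup>2 * (real CARD('k) * G * ?d)\<^sup>2"
    by (intro mult_left_mono) auto
  also have "\<dots> = \<alpha> * ?d\<^sup>2 / 2"
    unfolding steps[symmetric] by (simp add: power_mult_distrib)
  finally have "\<gamma>\<^sup>2 * ((norm (g t (x (Suc t))))\<^sup>2 + (norm (g t (x t)))\<^sup>2
      - 2 * inner (g t (x t)) (g t (x (Suc t)))) \<le> \<alpha> * ?d\<^sup>2 / 2"
    by (simp add: power2_norm_eq_inner inner_diff_left inner_diff_right inner_commute algebra_simps)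
  then have 4: "- (\<gamma>\<^sup>2 * inner (g t (x t)) (g t (x (Suc t)))) \<le> \<alpha> * ?d\<^sup>2 / 4
      - \<gamma>\<^sup>2 * (norm (g t (x (Suc t))))\<^sup>2 / 2 - \<gamma>\<^sup>2 * (norm (g t (x t)))\<^sup>2 / 2"
    by (simp add: algebra_simps)
  \<comment> \<open>Half of the quadratic term of \<open>drift\<close> is matched with the square of
    \<open>g t (x (Suc t))\<close> from the polarization, at the price of one variation; the other
    half telescopes in the potential.\<close>
  have "norm (g (Suc t) (x (Suc t))) \<le> norm (g t (x (Suc t))) + ?v"
    using g_variation[OF t S(2)] norm_triangle_ineq2[of "g (Suc t) (x (Suc t))" "g t (x (Suc t))"]
    by linarith
  then have "(norm (g (Suc t) (x (Suc t))) - norm (g t (x (Suc t))))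
      * (norm (g (Suc t) (x (Suc t))) + norm (g t (x (Suc t)))) \<le> ?v * (2 * F)"
    using g_le step_variation_nonneg[OF t] by (intro mult_mono) auto
  then have "\<gamma>\<^sup>2 * ((norm (g (Suc t) (x (Suc t))))\<^sup>2 - (norm (g t (x (Suc t))))\<^sup>2) \<le> \<gamma>\<^sup>2 * (?v * (2 * F))"
    by (intro mult_left_mono) (auto simp: power2_eq_square algebra_simps)
  then have 5: "\<gamma>\<^sup>2 * (norm (g (Suc t) (x (Suc t))))\<^sup>2 / 2
      - \<gamma>\<^sup>2 * (norm (g t (x (Suc t))))\<^sup>2 / 2 \<le> \<gamma>\<^sup>2 * F * ?v"
    by (simp add: algebra_simps)
  have 6: "\<gamma> * norm (lam t) * ?v \<le> \<gamma> * queue_bound * ?v"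
    using norm_lam_le[of t] step_variation_nonneg[OF t] t \<gamma>_pos
    by (intro mult_right_mono mult_left_mono) auto
  \<comment> \<open>Moving the comparator from \<open>xs t\<close> to \<open>xs (Suc t)\<close>: a
    difference of squares is factored, and the sum of the distances is at most twice the diameter
    bound.\<close>
  have "(norm (xs (Suc t) - x (Suc t)) - norm (xs t - x (Suc t)))
      * (norm (xs (Suc t) - x (Suc t)) + norm (xs t - x (Suc t))) \<le> norm (xs (Suc t) - xs t) * (2 * R)"
    using diam[of "xs (Suc t)" "x (Suc t)"] diam[of "xs t" "x (Suc t)"] S
      norm_triangle_ineq2[of "xs (Suc t) - x (Suc t)" "xs t - x (Suc t)"]
    by (intro mult_mono) auto
  then have "\<alpha> * ((norm (xs (Suc t) - x (Suc t)))\<^sup>2 - (norm (xs t - x (Suc t)))\<^sup>2)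
      \<le> \<alpha> * (norm (xs (Suc t) - xs t) * (2 * R))"
    using \<alpha>_pos by (intro mult_left_mono) (auto simp: power2_eq_square algebra_simps)
  then have 7: "\<alpha> * (norm (xs (Suc t) - x (Suc t)))\<^sup>2 - \<alpha> * (norm (xs t - x (Suc t)))\<^sup>2
      \<le> 2 * \<alpha> * R * norm (xs (Suc t) - xs t)"
    by (simp add: algebra_simps)
  have 8: "\<gamma> * inner ?w (g t (x (Suc t)))
      = \<gamma> * inner (lam t) (g t (x (Suc t))) + \<gamma>\<^sup>2 * inner (g t (x t)) (g t (x (Suc t)))"
    by (simp add: inner_add_left power2_eq_square algebra_simps)
  have 9: "(\<gamma>\<^sup>2 * F + \<gamma> * queue_bound) * ?v = \<gamma>\<^sup>2 * F * ?v + \<gamma> * queue_bound * ?v"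
    by (simp add: algebra_simps)
  have 10: "0 \<le> \<alpha> * ?d\<^sup>2"
    using \<alpha>_pos by simp
  show ?thesis
    unfolding potential_def 9
    using 1 2 3 4 5 6 7 8 10 descent[OF t S(3)] drift[OF t] by linarith
qed

section \<open>Summation over the horizon\<close>

lemma constraint_variation_eq: "constraint_variation T S g = (\<Sum>t\<in>{1..<T}. step_variation S g t)"
  unfolding constraint_variation_def
  by (rule sum.reindex_bij_witness[of _ Suc "\<lambda>t. t - 1"]) auto

lemma minimizer_variation_eq: "minimizer_variation T xs = (\<Sum>t\<in>{1..<T}. norm (xs (Suc t) - xs t))"
  unfolding minimizer_variation_def
  by (rule sum.reindex_bij_witness[of _ Suc "\<lambda>t. t - 1"]) (auto simp: numeral_2_eq_2)

lemma minimizer_variation_nonneg: "0 \<le> minimizer_variation T xs"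
  unfolding minimizer_variation_eq by (intro sum_nonneg) auto

lemma constraint_variation_nonneg: "0 \<le> constraint_variation T S g"
  unfolding constraint_variation_eq by (intro sum_nonneg step_variation_nonneg)

text \<open>Used for negative exponents, where \<alpha> may be below 1 and
  \<open>\<alpha> * constraint_variation T S g\<close> need not control the variation
  itself.\<close>

lemma constraint_variation_le: "constraint_variation T S g \<le> Vbar * real T"
proof -
  have "constraint_variation T S g \<le> (\<Sum>t\<in>{1..<T}. Vbar)"
    unfolding constraint_variation_eq by (intro sum_mono step_variation_le_Vbar)
  also have "\<dots> \<le> Vbar * real T"
    using Vbar_nonneg by (simp add: mult.commute mult_left_mono)
  finally show ?thesis .
qed

text \<open>Round \<open>T\<close> has no subsequent update and is bounded crudely by
  \<open>2 * F\<close>; the other rounds are summed and the potential telescopes.\<close>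

lemma regret_le:
  "regret T f xs x \<le> 2 * F + G\<^sup>2 * (real T / \<alpha>) + R\<^sup>2 * \<alpha>
    + (\<gamma>\<^sup>2 * F + \<gamma> * queue_bound) * constraint_variation T S g
    + 2 * R * (\<alpha> * minimizer_variation T xs)"
proof -
  let ?c = "\<gamma>\<^sup>2 * F + \<gamma> * queue_bound"
  have T: "{1..T} = insert T {1..<T}" "T \<in> {1..T}"
    using T_pos by auto
  have "regret T f xs x = (f T (x T) - f T (xs T)) + (\<Sum>t\<in>{1..<T}. f t (x t) - f t (xs t))"
    unfolding regret_def T(1) by (simp add: sum_subtractf)
  also have "f T (x T) - f T (xs T) \<le> 2 * F"
    using f_bound[OF T(2) x_S[OF T(2)]] f_bound[OF T(2) xs_S[OF T(2)]] by linarith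
  also have "(\<Sum>t\<in>{1..<T}. f t (x t) - f t (xs t)) \<le>
      (\<Sum>t\<in>{1..<T}. G\<^sup>2 / \<alpha> + ?c * step_variation S g t
        + 2 * \<alpha> * R * norm (xs (Suc t) - xs t) + (potential t - potential (Suc t)))"
    by (intro sum_mono regret_step)
  also have "\<dots> = (real T - 1) * (G\<^sup>2 / \<alpha>) + ?c * constraint_variation T S g
        + 2 * \<alpha> * R * minimizer_variation T xs + (potential 1 - potential T)"
    using T_pos sum_Suc_diff'[of 1 T "\<lambda>t. - potential t"]
    by (simp add: sum.distrib constraint_variation_eq minimizer_variation_eq sum_distrib_left of_nat_diff)
  also have "(real T - 1) * (G\<^sup>2 / \<alpha>) \<le> G\<^sup>2 * (real T / \<alpha>)"
    using \<alpha>_pos by (simp add: field_simps)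
  also have "potential 1 - potential T \<le> \<alpha> * R\<^sup>2"
    using potential_1_le potential_nonneg[OF T(2)] by linarith
  finally show ?thesis
    by (simp add: algebra_simps)
qed

text \<open>Eliminating \<open>\<gamma>\<^sup>2\<close> through \<open>steps\<close> exhibits an
  affine function of \<alpha> whose coefficients depend on the constants alone.\<close>

lemma scaled_queue_bound:
  "\<gamma> * queue_bound = G * R / (\<epsilon> - Vbar)
    + (R\<^sup>2 / (\<epsilon> - Vbar) + ((\<epsilon> * F + 2 * F\<^sup>2) / (\<epsilon> - Vbar) + F) / (2 * (real CARD('k) * G)\<^sup>2)) * \<alpha>"
proof -
  define d b where "d = \<epsilon> - Vbar" and "b = 2 * (real CARD('k) * G)\<^sup>2"
  have d: "0 < d" and b: "0 < b"
    using Vbar_less G_pos by (simp_all add: d_def b_def)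
  have sq: "\<gamma>\<^sup>2 = \<alpha> / b"
    using steps b unfolding b_def[symmetric] by (simp add: field_simps)
  have "\<gamma> * queue_bound = (G * R + \<alpha> * R\<^sup>2 + \<gamma>\<^sup>2 * (\<epsilon> * F + 2 * F\<^sup>2)) / d + \<gamma>\<^sup>2 * F"
    using \<gamma>_pos d unfolding queue_bound_def d_def[symmetric]
    by (simp add: power2_eq_square field_simps)
  also have "\<dots> = G * R / d + (R\<^sup>2 / d + ((\<epsilon> * F + 2 * F\<^sup>2) / d + F) / b) * \<alpha>"
    unfolding sq using d b by (simp add: field_simps)
  finally show ?thesis
    by (simp add: d_def b_def)
qed

end

section \<open>Bounds with constants uniform in the horizon and the problem\<close>

text \<open>The term \<open>R\<^sup>2 * \<alpha>\<close> of \<open>regret_le\<close> is dominated by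
  \<open>real T powr (1 - a)\<close> when \<open>a \<le> 1 / 2\<close>. For larger \<open>a\<close>
  it is absorbed using \<open>\<alpha> * v \<le> B\<close>, which costs a factor 1/v and makes the
  constant depend on \<open>v\<close>. The violation bound contains a multiple of 1/\<alpha>, which
  \<open>0 \<le> a\<close> keeps bounded.\<close>

theorem theorem2:
  fixes R F G \<epsilon> Vbar :: real
  assumes "0 < G" and "Vbar < \<epsilon>"
  shows "\<exists>(C :: real) (D :: real \<Rightarrow> real).
    \<forall>n T S f df (g :: nat \<Rightarrow> finseq \<Rightarrow> real^'k) dg xs x lam \<alpha> \<gamma>.
      1 \<le> T \<and> 0 < \<alpha> \<and> 0 < \<gamma> \<and>
      bounded_convex_problem R F G n T S f df g dg \<and>
      slater \<epsilon> T S g \<and>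
      max_step_variation T S g = Vbar \<and>
      offline_minimizers T S f g xs \<and>
      algorithm_run \<alpha> \<gamma> T S df g x lam \<longrightarrow>
      (let Reg = regret T f xs x;
           Vx = minimizer_variation T xs;
           Vg = constraint_variation T S g;
           \<beta> = real CARD('k) * G
       in
         (\<forall>a. \<alpha> = real T powr a \<and> \<gamma>\<^sup>2 = 1 / (2 * \<beta>\<^sup>2) * real T powr a \<longrightarrow>
            (let B = Max {real T powr a * Vx, real T powr a * Vg, real T powr (1 - a)} in
               (a \<le> 1 / 2 \<longrightarrow> Reg \<le> C * B) \<and>
               (\<forall>v>0. v \<le> max Vx Vg \<longrightarrow> Reg \<le> D v * B)) \<and>
            (0 \<le> a \<longrightarrow> (\<forall>k. violation T g x k \<le> C))) \<and>
         (\<alpha> = sqrt (real T) \<and> 2 * \<beta>\<^sup>2 * \<gamma>\<^sup>2 = sqrt (real T) \<longrightarrow>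
            (\<forall>v>0. v \<le> max Vx Vg \<longrightarrow>
               Reg \<le> D v * max (sqrt (real T) * Vx) (sqrt (real T) * Vg)) \<and>
            (\<forall>k. violation T g x k \<le> C)))"
proof -
  define b where "b = 2 * (real CARD('k) * G)\<^sup>2"
  \<comment> \<open>\<open>c0\<close> and \<open>c1\<close> are the coefficients from
    \<open>scaled_queue_bound\<close>. \<open>A\<close> collects the terms free of variation,
    \<open>A'\<close> the variation terms, and \<open>b * (c0 + c1)\<close> bounds the violation
    once \<alpha> is at least 1.\<close>
  define c0 where "c0 = G * R / (\<epsilon> - Vbar)"
  define c1 where "c1 = R\<^sup>2 / (\<epsilon> - Vbar) + ((\<epsilon> * F + 2 * F\<^sup>2) / (\<epsilon> - Vbar) + F) / b"
  define A where "A = 2 * F + G\<^sup>2 + R\<^sup>2"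
  define A' where "A' = F / b + c1 + c0 * (1 + Vbar) + 2 * R"
  define C where "C = A + A' + b * (c0 + c1)"
  define D where "D v = A + A' + A / v" for v
  have b: "0 < b"
    using assms by (simp add: b_def)
  show ?thesis
  proof (rule exI[of _ C], rule exI[of _ D], intro allI impI, goal_cases)
    case (1 n T S f df g dg xs x lam \<alpha> \<gamma>)
    then have T: "1 \<le> T" and \<alpha>: "0 < \<alpha>" and \<gamma>: "0 < \<gamma>"
      and prob: "bounded_convex_problem R F G n T S f df g dg"
      and slater: "slater \<epsilon> T S g"
      and Vbar: "max_step_variation T S g = Vbar"
      and xs: "offline_minimizers T S f g xs"
      and run: "algorithm_run \<alpha> \<gamma> T S df g x lam"
      by auto
    let ?Reg = "regret T f xs x"
    let ?Vx = "minimizer_variation T xs"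
    let ?Vg = "constraint_variation T S g"
    \<comment> \<open>The algorithm leaves \<open>lam T\<close> unspecified; the analysis needs one more queue update.\<close>
    define lam' where "lam' = lam(T := queue_update (lam (T - 1)) (\<gamma> *\<^sub>R g T (x T)))"
    have run': "algorithm_run \<alpha> \<gamma> T S df g x lam'"
      unfolding algorithm_run_def
    proof (intro conjI ballI)
      fix t assume t: "t \<in> {1..<T}"
      then have eq: "lam' t = lam t" "lam' (t - 1) = lam (t - 1)"
        by (auto simp: lam'_def)
      show "lam' t = (\<chi> k. max (lam' (t - 1) $ k + \<gamma> * g t (x t) $ k) (- \<gamma> * g t (x t) $ k))"
        and "is_arg_min (\<lambda>y. inner (df t (x t)) (y - x t)
            + inner (lam' t + \<gamma> *\<^sub>R g t (x t)) (\<gamma> *\<^sub>R g t y)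
            + \<alpha> * (norm (y - x t))\<^sup>2) (\<lambda>y. y \<in> S) (x (t + 1))"
        unfolding eq using run t unfolding algorithm_run_def by blast+
    qed (use run T in \<open>auto simp: algorithm_run_def lam'_def\<close>)
    have lam'_T: "lam' T = queue_update (lam' (T - 1)) (\<gamma> *\<^sub>R g T (x T))"
      using T by (auto simp: lam'_def)
    \<comment> \<open>The signs of \<open>R\<close>, \<open>F\<close> and \<open>Vbar\<close> are
      consequences of having an instance with nonempty \<open>S\<close>, so they are available only
      after one is fixed.\<close>
    have bounds: "0 \<le> R \<and> 0 \<le> F \<and> 0 \<le> Vbar \<and> 0 \<le> ?Vx \<and> 0 \<le> ?Vg \<and> ?Vg \<le> Vbar * T
      \<and> ?Reg \<le> 2 * F + G\<^sup>2 * (real T / \<alpha>) + R\<^sup>2 * \<alpha> + (F / b + c1) * (\<alpha> * ?Vg) + c0 * ?Vg + 2 * R * (\<alpha> * ?Vx)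
      \<and> (\<forall>k. violation T g x k \<le> b * (c0 / \<alpha> + c1))" if \<gamma>2: "b * \<gamma>\<^sup>2 = \<alpha>"
    proof -
      interpret virtual_queue_run R F G \<epsilon> Vbar \<alpha> \<gamma> n T S f df g dg xs x lam'
        using T \<alpha> \<gamma> prob slater Vbar xs run' lam'_T assms \<gamma>2
        unfolding b_def by unfold_locales auto
      have sq: "\<gamma>\<^sup>2 = \<alpha> / b"
        using \<gamma>2 b by (simp add: field_simps)
      have q: "\<gamma> * queue_bound = c0 + c1 * \<alpha>"
        using scaled_queue_bound by (simp add: c0_def c1_def b_def)
      have "queue_bound / \<gamma> = (\<gamma> * queue_bound) / \<gamma>\<^sup>2"
        using \<gamma> by (simp add: power2_eq_square)
      also have "\<dots> = b * (c0 / \<alpha> + c1)"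
        unfolding q sq using \<alpha> b by (simp add: field_simps)
      finally have "queue_bound / \<gamma> = b * (c0 / \<alpha> + c1)" .
      with violation_le have "\<forall>k. violation T g x k \<le> b * (c0 / \<alpha> + c1)"
        by metis
      moreover have "(\<gamma>\<^sup>2 * F + \<gamma> * queue_bound) * ?Vg = (F / b + c1) * (\<alpha> * ?Vg) + c0 * ?Vg"
        unfolding q sq by (simp add: algebra_simps)
      ultimately show ?thesis
        using regret_le R_nonneg F_nonneg Vbar_nonneg minimizer_variation_nonneg
          constraint_variation_nonneg constraint_variation_le by auto
    qed
    have nonneg: "0 \<le> R \<and> 0 \<le> F \<and> 0 \<le> Vbar \<and> 0 \<le> ?Vx \<and> 0 \<le> ?Vg \<and> 0 \<le> c0 \<and> 0 \<le> c1 \<and> 0 \<le> A \<and> 0 \<le> A'"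
      if \<gamma>2: "b * \<gamma>\<^sup>2 = \<alpha>"
    proof -
      have *: "0 \<le> R" "0 \<le> F" "0 \<le> Vbar"
        using bounds[OF \<gamma>2] by auto
      have "0 \<le> c0" "0 \<le> c1"
        unfolding c0_def c1_def using * assms b by auto
      with * show ?thesis
        using bounds[OF \<gamma>2] b by (simp add: A_def A'_def)
    qed
    \<comment> \<open>Here \<open>w\<close> majorizes the terms free of variation and
      \<open>B\<close> the variation terms; the regimes differ only in the choice of
      \<open>w\<close>.\<close>
    have regret: "?Reg \<le> A * w + A' * B"
      if \<gamma>2: "b * \<gamma>\<^sup>2 = \<alpha>" and w: "1 \<le> w" "real T / \<alpha> \<le> w" "\<alpha> \<le> w"
        and B: "\<alpha> * ?Vg \<le> B" "?Vg \<le> (1 + Vbar) * B" "\<alpha> * ?Vx \<le> B" for w B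
    proof -
      note nn = nonneg[OF \<gamma>2]
      have "?Reg \<le> 2 * F * 1 + G\<^sup>2 * (real T / \<alpha>) + R\<^sup>2 * \<alpha>
          + (F / b + c1) * (\<alpha> * ?Vg) + c0 * ?Vg + 2 * R * (\<alpha> * ?Vx)"
        using bounds[OF \<gamma>2] by simp
      also have "\<dots> \<le> 2 * F * w + G\<^sup>2 * w + R\<^sup>2 * w + (F / b + c1) * B + c0 * ((1 + Vbar) * B) + 2 * R * B"
        using nn b by (intro add_mono mult_left_mono w B) auto
      finally show ?thesis
        by (simp add: A_def A'_def algebra_simps)
    qed
    have vio: "violation T g x k \<le> C" if \<gamma>2: "b * \<gamma>\<^sup>2 = \<alpha>" and "1 \<le> \<alpha>" for k
    proof -
      note nn = nonneg[OF \<gamma>2]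
      have "violation T g x k \<le> b * (c0 / \<alpha> + c1)"
        using bounds[OF \<gamma>2] by blast
      also have "c0 / \<alpha> \<le> c0 / 1"
        using nn that \<alpha> by (intro divide_left_mono) auto
      finally show ?thesis
        using nn b unfolding C_def by simp
    qed
    have regret_v: "?Reg \<le> D v * B"
      if \<gamma>2: "b * \<gamma>\<^sup>2 = \<alpha>" and \<alpha>1: "1 \<le> \<alpha>" and v: "0 < v" "v \<le> max ?Vx ?Vg"
        and B: "\<alpha> * ?Vx \<le> B" "\<alpha> * ?Vg \<le> B" "real T / \<alpha> \<le> max \<alpha> B" for v B
    proof -
      note nn = nonneg[OF \<gamma>2]
      \<comment> \<open>The lower bound \<open>v\<close> on the variations turns \<alpha> into at
        most \<open>B / v\<close>, so \<open>w\<close> can be taken as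
        \<open>B + B / v\<close>.\<close>
      have "\<alpha> * v \<le> \<alpha> * max ?Vx ?Vg"
        using v \<alpha> by simp
      also have "\<dots> \<le> B"
        using B by (simp add: max_def)
      finally have \<alpha>_le: "\<alpha> \<le> B / v"
        using v by (simp add: field_simps)
      have B0: "0 \<le> B"
        using B(2) nn \<alpha> by (meson less_eq_real_def mult_nonneg_nonneg order_trans)
      have "?Vg \<le> \<alpha> * ?Vg"
        using \<alpha>1 nn by (simp add: mult_le_cancel_right1)
      also have "\<dots> \<le> (1 + Vbar) * B"
        using B B0 nn by (simp add: distrib_right add_increasing2)
      finally have "?Vg \<le> (1 + Vbar) * B" .
      moreover have "0 \<le> B / v"
        using B0 v by simp
      ultimately have "?Reg \<le> A * (B + B / v) + A' * B"
        using \<gamma>2 \<alpha>1 \<alpha>_le B B0 by (intro regret) auto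
      also have "\<dots> = D v * B"
        by (simp add: D_def algebra_simps)
      finally show ?thesis .
    qed
    have power_case: "(a \<le> 1 / 2 \<longrightarrow> ?Reg \<le> C * B) \<and> (\<forall>v>0. v \<le> max ?Vx ?Vg \<longrightarrow> ?Reg \<le> D v * B)
        \<and> (0 \<le> a \<longrightarrow> (\<forall>k. violation T g x k \<le> C))"
      if a: "\<alpha> = real T powr a" "\<gamma>\<^sup>2 = 1 / b * real T powr a"
        and B_def: "B = Max {real T powr a * ?Vx, real T powr a * ?Vg, real T powr (1 - a)}" for a B
    proof -
      have \<gamma>2: "b * \<gamma>\<^sup>2 = \<alpha>"
        using a b by simp
      note nn = nonneg[OF \<gamma>2]
      have B: "\<alpha> * ?Vx \<le> B" "\<alpha> * ?Vg \<le> B" "real T powr (1 - a) \<le> B"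
        unfolding B_def a(1) by (auto intro!: Max_ge)
      have quot: "real T / \<alpha> = real T powr (1 - a)"
        using T by (simp add: a(1) powr_diff)
      have B0: "0 \<le> B"
        using B(3) powr_ge_zero order_trans by blast
      have \<alpha>1: "1 \<le> \<alpha>" if "0 \<le> a"
        using that T by (simp add: a(1) ge_one_powr_ge_zero)
      \<comment> \<open>For these exponents \<open>real T powr (1 - a)\<close> dominates both 1 and
        \<alpha>, so \<open>w = B\<close> works.\<close>
      have small: "?Reg \<le> (A + A') * B" if "a \<le> 1 / 2"
      proof -
        have "1 \<le> real T powr (1 - a)" "\<alpha> \<le> real T powr (1 - a)"
          using that T by (auto simp: a(1) intro!: ge_one_powr_ge_zero powr_mono)
        moreover have "?Vg \<le> (1 + Vbar) * B"
        proof (cases "0 \<le> a")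
          case True
          then have "?Vg \<le> \<alpha> * ?Vg"
            using \<alpha>1 nn by (simp add: mult_le_cancel_right1)
          also have "\<dots> \<le> (1 + Vbar) * B"
            using B B0 nn by (simp add: distrib_right add_increasing2)
          finally show ?thesis .
        next
          case False
          \<comment> \<open>For negative \<open>a\<close> the last entry of the maximum already
            exceeds \<open>T\<close>, which controls the total constraint variation.\<close>
          then have "real T powr 1 \<le> real T powr (1 - a)"
            using T by (intro powr_mono) auto
          then have "real T \<le> B"
            using T B by simp
          then have "Vbar * real T \<le> Vbar * B"
            using nn by (intro mult_left_mono) auto
          then show ?thesis
            using bounds[OF \<gamma>2] B0 by (simp add: distrib_right)
        qed
        ultimately have "?Reg \<le> A * B + A' * B"
          using B quot by (intro regret \<gamma>2) auto
        then show ?thesis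
          by (simp add: distrib_right)
      qed
      have "?Reg \<le> C * B" if "a \<le> 1 / 2"
      proof -
        have "(A + A') * B \<le> C * B"
          using nn b B0 unfolding C_def by (intro mult_right_mono) auto
        with small[OF that] show ?thesis
          by simp
      qed
      moreover have "?Reg \<le> D v * B" if v: "0 < v" "v \<le> max ?Vx ?Vg" for v
      proof (cases "a \<le> 1 / 2")
        case True
        have "(A + A') * B \<le> D v * B"
          using nn v B0 unfolding D_def by (intro mult_right_mono) auto
        with small[OF True] show ?thesis
          by simp
      next
        case False
        then show ?thesis
          using \<alpha>1 B quot v by (intro regret_v \<gamma>2) auto
      qed
      ultimately show ?thesis
        using vio \<gamma>2 \<alpha>1 by blast
    qed
    have sqrt_case: "(\<forall>v>0. v \<le> max ?Vx ?Vg \<longrightarrow>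
          ?Reg \<le> D v * max (sqrt (real T) * ?Vx) (sqrt (real T) * ?Vg))
        \<and> (\<forall>k. violation T g x k \<le> C)"
      if a: "\<alpha> = sqrt (real T)" "b * \<gamma>\<^sup>2 = sqrt (real T)"
    proof -
      have \<gamma>2: "b * \<gamma>\<^sup>2 = \<alpha>" and \<alpha>1: "1 \<le> \<alpha>"
        using a T by auto
      \<comment> \<open>This meets the condition
        \<open>real T / \<alpha> \<le> max \<alpha> B\<close> of \<open>regret_v\<close> even though
        \<open>B\<close> now lacks the entry \<open>real T powr (1 - a)\<close>.\<close>
      have "real T / \<alpha> = \<alpha>"
        by (simp add: a(1) real_div_sqrt)
      then have "?Reg \<le> D v * max (sqrt (real T) * ?Vx) (sqrt (real T) * ?Vg)"
        if "0 < v" "v \<le> max ?Vx ?Vg" for v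
        using that by (intro regret_v \<gamma>2 \<alpha>1) (auto simp: a(1))
      then show ?thesis
        using vio[OF \<gamma>2 \<alpha>1] by blast
    qed
    show ?case
      unfolding Let_def b_def[symmetric] using power_case sqrt_case by blast
  qed
qed

end
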